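(* Let $\chi$ be a primitive nonprincipal Dirichlet character with conductor $q$, and let $\Phi=\{j\mid 1\le j\le q-1,\ \gcd(j,q)=1\}$. Then for all integers $n\ge 1$, $$L_n^*(\chi)=\frac{(-1)^n}{q^n}\sum_{(k_j)_{j\in\Phi}}\ \prod_{j\in\Phi}\frac{\chi(j)^{k_j}}{k_j!}\sum_{k=1}^{k_j}B_{k_j,k}\left(\psi(\tfrac jq),\psi_1(\tfrac jq),\ldots,\psi_{k_j-k}(\tfrac jq)\right),$$ where the outer sum is over all families $(k_j)_{j\in\Phi}$ of nonnegative integers with $\sum_{j\in\Phi}k_j=n$, and where for $k_j=0$ the factor of the product belonging to $j$ is understood to be $1$.
   Context: $L_n^*(\chi):=\sum_{1\le k_1\le\dots\le k_n}\frac{\chi(k_1)}{k_1}\cdots\frac{\chi(k_n)}{k_n}$, understood as the limit as $N\to\infty$ of the sums over $1\le k_1\le\dots\le k_n\le N$. $\psi(y)=\Gamma'(y)/\Gamma(y)$ is the digamma function, $\psi_0=\psi$, and $\psi_j=\psi^{(j)}$ is its $j$th derivative for $j\ge1$. For $1\le k\le n$, the partial exponential Bell polynomial is $$B_{n,k}(x_1,\ldots,x_{n-k+1})=\sum\frac{n!}{j_1!\cdots j_{n-k+1}!}\left(\frac{x_1}{1!}\right)^{j_1}\cdots\left(\frac{x_{n-k+1}}{(n-k+1)!}\right)^{j_{n-k+1}},$$ summed over all nonnegative integers $j_1,\ldots,j_{n-k+1}$ with $j_1+j_2+\dots+j_{n-k+1}=k$ and $j_1+2j_2+\dots+(n-k+1)j_{n-k+1}=n$.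 *)

theory Defs
  imports "HOL-Analysis.Analysis"
begin

definition dirichlet_character :: "nat \<Rightarrow> (int \<Rightarrow> complex) \<Rightarrow> bool" where
  "dirichlet_character q chi \<longleftrightarrow>
     q > 0 \<and>
     (\<forall>a b. chi (a * b) = chi a * chi b) \<and>
     (\<forall>a. chi (a + int q) = chi a) \<and>
     (\<forall>a. chi a = 0 \<longleftrightarrow> \<not> coprime a (int q))"

definition principal_character :: "nat \<Rightarrow> (int \<Rightarrow> complex) \<Rightarrow> bool" where
  "principal_character q chi \<longleftrightarrow>
     dirichlet_character q chi \<and> (\<forall>a. coprime a (int q) \<longrightarrow> chi a = 1)"

text \<open>The least modulus \<open>d\<close> dividing \<open>q\<close> such that the character \<open>chi\<close> modulo \<open>q\<close> is induced by a
  character modulo \<open>d\<close>; the set of such \<open>d\<close> contains \<open>q\<close>.\<close>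

definition conductor :: "nat \<Rightarrow> (int \<Rightarrow> complex) \<Rightarrow> nat" where
  "conductor q chi =
     (LEAST d. d dvd q \<and>
        (\<exists>chi'. dirichlet_character d chi' \<and> (\<forall>a. coprime a (int q) \<longrightarrow> chi a = chi' a)))"

definition primitive_character :: "nat \<Rightarrow> (int \<Rightarrow> complex) \<Rightarrow> bool" where
  "primitive_character q chi \<longleftrightarrow> dirichlet_character q chi \<and> conductor q chi = q"

definition L_star_partial :: "nat \<Rightarrow> (int \<Rightarrow> complex) \<Rightarrow> nat \<Rightarrow> complex" where
  "L_star_partial n chi N =
     (\<Sum>ks | length ks = n \<and> sorted ks \<and> set ks \<subseteq> {1..N}. \<Prod>k\<leftarrow>ks. chi (int k) / of_nat k)"

text \<open>Only meaningful if the sequence of partial sums converges.\<close>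

definition L_star :: "nat \<Rightarrow> (int \<Rightarrow> complex) \<Rightarrow> complex" where
  "L_star n chi = lim (L_star_partial n chi)"

text \<open>The partial exponential Bell polynomial, for \<open>1 \<le> k \<le> n\<close>. The arguments are indexed from
  \<open>1\<close>; only \<open>x 1, \<dots>, x (n - k + 1)\<close> matter.\<close>

definition bell_poly :: "nat \<Rightarrow> nat \<Rightarrow> (nat \<Rightarrow> 'a :: field_char_0) \<Rightarrow> 'a" where
  "bell_poly n k x =
     (\<Sum>j \<in> {j \<in> {1..n-k+1} \<rightarrow>\<^sub>E (UNIV :: nat set).
              (\<Sum>i=1..n-k+1. j i) = k \<and> (\<Sum>i=1..n-k+1. i * j i) = n}.
        fact n / (\<Prod>i=1..n-k+1. fact (j i)) * (\<Prod>i=1..n-k+1. (x i / fact i) ^ j i))"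

text \<open>The library's \<^const>\<open>Polygamma\<close> is the iterated derivative of the logarithmic derivative of
  \<^const>\<open>Gamma\<close>.\<close>

lemma Digamma_conv_deriv_Gamma:
  fixes z :: complex
  assumes "z \<notin> \<int>\<^sub>\<le>\<^sub>0"
  shows   "Digamma z = deriv Gamma z / Gamma z"
proof -
  have "deriv Gamma z = Gamma z * Digamma z"
    using assms by (intro DERIV_imp_deriv has_field_derivative_Gamma)
  with assms show ?thesis
    by (simp add: Gamma_eq_zero_iff)
qed

lemma Polygamma_conv_deriv_Digamma:
  fixes z :: complex
  assumes "z \<notin> \<int>\<^sub>\<le>\<^sub>0"
  shows   "Polygamma j z = (deriv ^^ j) Digamma z"
  using higher_deriv_Polygamma[OF assms, of j 0] by simp

end

theory Submission
  imports Defs "HOL-Number_Theory.Cong"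
begin

text \<open>
  The partial sums \<open>h\<^sub>n(N)\<close> of \<open>L\<^sub>n\<^sup>*\<close> are the complete homogeneous symmetric polynomials in the numbers
  \<open>\<chi>(k)/k\<close>, \<open>k \<le> N\<close>. By Newton's identity \<open>(n+1) h\<^sub>n\<^sub>+\<^sub>1 = \<Sum>\<^sub>i h\<^sub>i p\<^sub>n\<^sub>-\<^sub>i\<^sub>+\<^sub>1\<close> they converge as soon as the
  power sums \<open>p\<^sub>r(N)\<close> do. Splitting \<open>p\<^sub>r\<close> into residue classes modulo \<open>q\<close> gives its limit
  \<open>\<Sum>\<^sub>j (-\<chi>(j)/q)\<^sup>r \<psi>\<^sub>r\<^sub>-\<^sub>1(j/q) / (r-1)!\<close>; for \<open>r = 1\<close> the divergent logarithms cancel because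
  \<open>\<Sum>\<^sub>j \<chi>(j) = 0\<close>. On the other side, \<open>\<Sum>\<^sub>k B\<^sub>n\<^sub>,\<^sub>k(x) / n!\<close> is the coefficient of \<open>X\<^sup>n\<close> in the formal power
  series \<open>\<Prod>\<^sub>i exp(x\<^sub>i X\<^sup>i / i!)\<close>, so the right-hand side of the theorem is a coefficient of a product of
  power series whose logarithmic derivative is the generating function of the limits of the
  power sums. Hence both sides satisfy the same recursion.
\<close>

unbundle no vec_syntax
unbundle fps_syntax

section \<open>Coefficients of finite products of power series\<close>

lemma finite_weighted_compositions:
  fixes w :: "'a \<Rightarrow> nat"
  assumes "finite A" and "\<And>i. i \<in> A \<Longrightarrow> w i > 0"
  shows "finite {\<kappa> \<in> A \<rightarrow>\<^sub>E (UNIV :: nat set). (\<Sum>i\<in>A. w i * \<kappa> i) = n}"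
proof (rule finite_subset)
  show "{\<kappa> \<in> A \<rightarrow>\<^sub>E UNIV. (\<Sum>i\<in>A. w i * \<kappa> i) = n} \<subseteq> A \<rightarrow>\<^sub>E {..n}"
  proof
    fix \<kappa> assume *: "\<kappa> \<in> {\<kappa> \<in> A \<rightarrow>\<^sub>E UNIV. (\<Sum>i\<in>A. w i * \<kappa> i) = n}"
    have "\<kappa> i \<le> n" if "i \<in> A" for i
    proof -
      have "\<kappa> i \<le> w i * \<kappa> i"
        using assms(2)[OF that] by simp
      also have "\<dots> \<le> (\<Sum>i\<in>A. w i * \<kappa> i)"
        using assms(1) that by (intro member_le_sum) auto
      finally show ?thesis using * by simp
    qed
    with * show "\<kappa> \<in> A \<rightarrow>\<^sub>E {..n}"
      by (auto simp: PiE_iff)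
  qed
qed (use assms in \<open>auto intro: finite_PiE\<close>)

text \<open>Substituting \<open>X^w\<close> moves the coefficient \<open>f $ k\<close> to position
  \<open>w * k\<close> and leaves zeros elsewhere, so the Cauchy product only sees these positions.
  Positivity of \<open>w\<close> bounds \<open>k\<close> by \<open>n\<close> and keeps the sum
  finite.\<close>

lemma fps_compose_X_power_mult_nth:
  fixes f g :: "'a :: comm_ring_1 fps"
  assumes "w > 0"
  shows "((f oo fps_X ^ w) * g) $ n = (\<Sum>k | w * k \<le> n. f $ k * g $ (n - w * k))"
proof -
  have le: "k \<le> n" if "w * k \<le> n" for k n
    using that assms by (metis One_nat_def Suc_leI le_trans mult_le_mono1 nat_mult_1)
  have coeff: "(f oo fps_X ^ w) $ m = (\<Sum>k=0..n. if w * k = m then f $ k else 0)" if "m \<le> n" for m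
  proof -
    have "(f oo fps_X ^ w) $ m = (\<Sum>k=0..m. if w * k = m then f $ k else 0)"
      unfolding fps_compose_nth by (intro sum.cong) (auto simp flip: power_mult)
    also have "\<dots> = (\<Sum>k=0..n. if w * k = m then f $ k else 0)"
      using that le[of _ m] by (intro sum.mono_neutral_left) auto
    finally show ?thesis .
  qed
  have "((f oo fps_X ^ w) * g) $ n =
      (\<Sum>m=0..n. \<Sum>k=0..n. if w * k = m then f $ k * g $ (n - m) else 0)"
    unfolding fps_mult_nth by (intro sum.cong refl) (auto simp: coeff sum_distrib_right intro!: sum.cong)
  also have "\<dots> = (\<Sum>k=0..n. \<Sum>m=0..n. if w * k = m then f $ k * g $ (n - m) else 0)"
    by (rule sum.swap)
  also have "\<dots> = (\<Sum>k=0..n. if w * k \<le> n then f $ k * g $ (n - w * k) else 0)"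
    by (intro sum.cong refl) (simp add: sum.delta')
  also have "\<dots> = (\<Sum>k | w * k \<le> n. f $ k * g $ (n - w * k))"
    using le[of _ n] by (intro sum.mono_neutral_cong_right) auto
  finally show ?thesis .
qed

text \<open>Induction on \<open>A\<close>, splitting off the exponent of the new factor. Weights
  \<open>w i = i\<close> produce the index sets of Bell polynomials, constant weights 1 the families
  with prescribed sum in the theorem.\<close>

lemma fps_prod_compose_X_power_nth:
  fixes f :: "'b \<Rightarrow> 'a :: comm_ring_1 fps"
  assumes "finite A" and "\<And>i. i \<in> A \<Longrightarrow> w i > 0"
  shows "(\<Prod>i\<in>A. f i oo fps_X ^ w i) $ n =
    (\<Sum>\<kappa> \<in> {\<kappa> \<in> A \<rightarrow>\<^sub>E (UNIV :: nat set). (\<Sum>i\<in>A. w i * \<kappa> i) = n}. \<Prod>i\<in>A. f i $ \<kappa> i)"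
  using assms
proof (induction A arbitrary: n rule: finite_induct)
  case empty
  show ?case by (cases "n = 0") (simp_all add: Collect_conv_if)
next
  case (insert a A)
  define S where "S m = {\<kappa> \<in> A \<rightarrow>\<^sub>E (UNIV :: nat set). (\<Sum>i\<in>A. w i * \<kappa> i) = m}" for m
  define T where "T = {\<kappa> \<in> insert a A \<rightarrow>\<^sub>E (UNIV :: nat set). (\<Sum>i\<in>insert a A. w i * \<kappa> i) = n}"
  have le: "k \<le> n" if "w a * k \<le> n" for k
    using that insert.prems[of a]
    by (metis One_nat_def Suc_leI insertI1 le_trans mult_le_mono1 nat_mult_1)
  have fin: "finite {k. w a * k \<le> n}"
    by (rule finite_subset[of _ "{..n}"]) (use le in auto)
  have split: "(\<Sum>i\<in>A. w i * (if i = a then y else g i)) = (\<Sum>i\<in>A. w i * g i)" for g y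
    using insert.hyps by (intro sum.cong) auto
  have splitp: "(\<Prod>i\<in>A. f i $ (if i = a then y else g i)) = (\<Prod>i\<in>A. f i $ g i)" for g y
    using insert.hyps by (intro prod.cong) auto
  have "(\<Prod>i\<in>insert a A. f i oo fps_X ^ w i) $ n =
      (\<Sum>k | w a * k \<le> n. f a $ k * (\<Sum>\<kappa>\<in>S (n - w a * k). \<Prod>i\<in>A. f i $ \<kappa> i))"
    using insert by (simp add: fps_compose_X_power_mult_nth S_def)
  also have "\<dots> = (\<Sum>(k, \<kappa>) \<in> (SIGMA k:{k. w a * k \<le> n}. S (n - w a * k)). f a $ k * (\<Prod>i\<in>A. f i $ \<kappa> i))"
    unfolding sum_distrib_left S_def
    by (intro sum.Sigma ballI fin finite_weighted_compositions) (use insert in auto)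
  also have "\<dots> = (\<Sum>\<kappa>\<in>T. \<Prod>i\<in>insert a A. f i $ \<kappa> i)"
  \<comment> \<open>A family on \<open>insert a A\<close> is its value at \<open>a\<close> together
    with its restriction to \<open>A\<close>. Extensionality demands that the restriction be
    \<open>undefined\<close> at \<open>a\<close>.\<close>
  proof (rule sum.reindex_bij_witness[of _ "\<lambda>\<kappa>. (\<kappa> a, \<kappa>(a := undefined))" "\<lambda>(k, \<kappa>). \<kappa>(a := k)"], goal_cases)
    case (1 p)
    then show ?case
      using insert.hyps by (auto simp: S_def PiE_iff extensional_def fun_eq_iff)
  next
    case (2 p)
    then show ?case
      using insert.hyps by (auto simp: S_def T_def PiE_iff extensional_def split)
  next
    case (3 \<kappa>)
    then show ?case by auto
  next
    case (4 \<kappa>)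
    then show ?case
      using insert.hyps by (auto simp: S_def T_def PiE_iff extensional_def split)
  next
    case (5 p)
    then show ?case
      using insert.hyps by (auto simp: splitp)
  qed
  finally show ?case by (simp only: T_def)
qed

lemma fps_prod_nth_PiE:
  fixes f :: "'b \<Rightarrow> 'a :: comm_ring_1 fps"
  assumes "finite A"
  shows "(\<Prod>i\<in>A. f i) $ n =
    (\<Sum>\<kappa> \<in> {\<kappa> \<in> A \<rightarrow>\<^sub>E (UNIV :: nat set). (\<Sum>i\<in>A. \<kappa> i) = n}. \<Prod>i\<in>A. f i $ \<kappa> i)"
  using fps_prod_compose_X_power_nth[OF assms, of "\<lambda>_. 1" f n] by simp

section \<open>Logarithmic derivatives and the generating function of Bell polynomials\<close>

lemma fps_deriv_prod_logderiv:
  fixes f Q :: "'b \<Rightarrow> 'a :: comm_ring_1 fps"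
  assumes "finite A" and "\<And>i. i \<in> A \<Longrightarrow> fps_deriv (f i) = f i * Q i"
  shows "fps_deriv (\<Prod>i\<in>A. f i) = (\<Prod>i\<in>A. f i) * (\<Sum>i\<in>A. Q i)"
  using assms by (induction A rule: finite_induct) (simp_all add: algebra_simps)

lemma fps_deriv_exp_compose_X_power:
  fixes y :: "'a :: field_char_0"
  assumes "i > 0"
  shows "fps_deriv (fps_exp y oo fps_X ^ i) =
    (fps_exp y oo fps_X ^ i) * (fps_const (of_nat i * y) * fps_X ^ (i - 1))"
  using assms
  by (subst fps_compose_deriv)
     (auto simp: fps_deriv_power fps_compose_mult_distrib algebra_simps fps_const_mult[symmetric]
           simp del: fps_const_mult)

text \<open>Expanding the factors \<open>exp(x_i X^i / i!)\<close> turns the coefficient of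
  \<open>X^n\<close> into a sum over all \<open>j\<close> with \<open>\<Sum> i * j i = n\<close>;
  grouping by \<open>k = \<Sum> j i\<close> yields the Bell polynomials. The remaining work is to
  match families on \<open>{1..n}\<close> with families on \<open>{1..n-k+1}\<close>.\<close>

lemma sum_bell_poly:
  fixes x :: "nat \<Rightarrow> 'a :: field_char_0"
  assumes "n > 0"
  shows "(\<Sum>k=1..n. bell_poly n k x) =
    fact n * (\<Prod>i=1..n. fps_exp (x i / fact i) oo fps_X ^ i) $ n"
proof -
  define S where "S = {j \<in> {1..n} \<rightarrow>\<^sub>E (UNIV :: nat set). (\<Sum>i=1..n. i * j i) = n}"
  define t where "t m j = (\<Prod>i=1..m. (x i / fact i) ^ j i / fact (j i))" for m and j :: "nat \<Rightarrow> nat"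
  have finS: "finite S"
    unfolding S_def by (rule finite_weighted_compositions) auto
  have S_k: "(\<Sum>i=1..n. j i) \<in> {1..n}" if "j \<in> S" for j
  proof -
    have "(\<Sum>i=1..n. j i) \<le> (\<Sum>i=1..n. i * j i)"
      by (intro sum_mono) auto
    moreover have "(\<Sum>i=1..n. j i) \<noteq> 0"
    proof
      assume "(\<Sum>i=1..n. j i) = 0"
      hence "(\<Sum>i=1..n. i * j i) = 0" by (intro sum.neutral) auto
      with that assms show False by (simp add: S_def)
    qed
    ultimately show ?thesis using that by (simp add: S_def del: sum_eq_0_iff)
  qed
  have "(\<Prod>i=1..n. fps_exp (x i / fact i) oo fps_X ^ i) $ n = (\<Sum>j\<in>S. t n j)"
    unfolding S_def t_def by (subst fps_prod_compose_X_power_nth) auto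
  also have "\<dots> = (\<Sum>k=1..n. \<Sum>j | j \<in> S \<and> (\<Sum>i=1..n. j i) = k. t n j)"
    using S_k finS by (intro sum.group[symmetric]) auto
  also have "fact n * \<dots> = (\<Sum>k=1..n. bell_poly n k x)"
    unfolding sum_distrib_left
  proof (intro sum.cong refl)
    fix k assume k: "k \<in> {1..n}"
    define m where "m = n - k + 1"
    have m: "m \<le> n" using k unfolding m_def by auto
    \<comment> \<open>The sum of \<open>(i - 1) * j i\<close> is \<open>n - k\<close>, so \<open>j\<close> vanishes beyond \<open>n - k + 1\<close>.\<close>
    have zero: "j i = 0" if "j \<in> S" "(\<Sum>i=1..n. j i) = k" "i \<in> {1..n}" "i > m" for j i
    proof (rule ccontr)
      assume "j i \<noteq> 0"
      have "(\<Sum>i=1..n. (i - 1) * j i) + (\<Sum>i=1..n. j i) = (\<Sum>i=1..n. i * j i)"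
        unfolding sum.distrib[symmetric] by (intro sum.cong) (auto simp: algebra_simps diff_mult_distrib)
      hence "(\<Sum>i=1..n. (i - 1) * j i) = n - k"
        using that by (simp add: S_def)
      moreover have "(i - 1) * j i \<le> (\<Sum>i=1..n. (i - 1) * j i)"
        using that by (intro member_le_sum) auto
      moreover have "(i - 1) * 1 \<le> (i - 1) * j i"
        using \<open>j i \<noteq> 0\<close> by (intro mult_le_mono) auto
      ultimately show False
        using \<open>i > m\<close> unfolding m_def by linarith
    qed
    have cut: "sum h {1..n} = sum h {1..m}" if "\<And>i. i \<in> {1..n} \<Longrightarrow> i > m \<Longrightarrow> h i = 0"
      for h :: "nat \<Rightarrow> nat"
      using m that by (intro sum.mono_neutral_right) auto
    have cutp: "prod h {1..n} = prod h {1..m}" if "\<And>i. i \<in> {1..n} \<Longrightarrow> i > m \<Longrightarrow> h i = 1"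
      for h :: "nat \<Rightarrow> 'a"
      using m that by (intro prod.mono_neutral_right) auto
    \<comment> \<open>Inverse of restriction to \<open>{1..m}\<close>: the new entries up to
      \<open>n\<close> are 0, and beyond \<open>n\<close> the value must be \<open>undefined\<close>
      for extensionality.\<close>
    define extend where "extend j i = (if i \<in> {1..m} then j i else if i \<in> {1..n} then 0 else undefined)"
      for j :: "nat \<Rightarrow> nat" and i
    have extend_sum: "(\<Sum>i=1..n. h i (extend j i)) = (\<Sum>i=1..m. h i (j i))" if "\<And>i. h i 0 = 0"
      for h :: "nat \<Rightarrow> nat \<Rightarrow> nat" and j
      using that by (subst cut) (auto simp: extend_def intro!: sum.cong)
    define T where "T = {j \<in> {1..m} \<rightarrow>\<^sub>E (UNIV :: nat set). (\<Sum>i=1..m. j i) = k \<and> (\<Sum>i=1..m. i * j i) = n}"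
    have "(\<Sum>j | j \<in> S \<and> (\<Sum>i=1..n. j i) = k. fact n * t n j) = (\<Sum>j\<in>T. fact n * t m j)"
    proof (rule sum.reindex_bij_witness[of _ extend "\<lambda>j. restrict j {1..m}"], goal_cases)
      case (1 j)
      have "j i = undefined" if "i \<notin> {1..n}" for i
        using 1 that by (simp add: S_def PiE_iff extensional_def)
      moreover have "j i = 0" if "i \<in> {1..n}" "i \<notin> {1..m}" for i
        using zero[of j i] 1 that by simp
      ultimately have "extend (restrict j {1..m}) i = j i" for i
        using m by (simp add: extend_def)
      then show ?case ..
    next
      case (2 j)
      have "sum j {1..n} = sum j {1..m}" "(\<Sum>i=1..n. i * j i) = (\<Sum>i=1..m. i * j i)"
        by (rule cut; use zero[of j] 2 in simp)+
      then show ?case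
        using 2 by (simp add: T_def S_def)
    next
      case (3 j)
      then show ?case
        by (auto simp: extend_def fun_eq_iff T_def PiE_iff extensional_def restrict_def)
    next
      case (4 j)
      have "extend j \<in> {1..n} \<rightarrow>\<^sub>E UNIV"
        using m by (simp add: PiE_iff extensional_def extend_def)
      moreover have "(\<Sum>i=1..n. extend j i) = k" "(\<Sum>i=1..n. i * extend j i) = n"
        using extend_sum[of "\<lambda>i y. y" j] extend_sum[of "\<lambda>i y. i * y" j] 4 by (simp_all add: T_def)
      ultimately show ?case
        by (simp add: S_def)
    next
      case (5 j)
      \<comment> \<open>Each factor of index above \<open>m\<close> has exponent 0 and hence equals
        1.\<close>
      have "t n j = t m j"
        unfolding t_def by (rule cutp) (use zero[of j] 5 in simp)
      then show ?case
        by (simp add: t_def)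
    qed
    also have "\<dots> = bell_poly n k x"
      unfolding bell_poly_def T_def m_def t_def by (intro sum.cong refl) (simp add: prod_dividef)
    finally show "(\<Sum>j | j \<in> S \<and> (\<Sum>i=1..n. j i) = k. fact n * t n j) = bell_poly n k x" .
  qed
  finally show ?thesis ..
qed

text \<open>The exponential generating function of the complete Bell polynomials. The constant
  coefficient is set separately: the sum over \<open>k=1..0\<close> is empty, whereas the convention
  for \<open>k_j = 0\<close> calls for 1.\<close>

definition complete_bell_fps :: "(nat \<Rightarrow> 'a :: field_char_0) \<Rightarrow> 'a fps" where
  "complete_bell_fps x =
     Abs_fps (\<lambda>n. if n = 0 then 1 else (\<Sum>k=1..n. bell_poly n k x) / fact n)"

text \<open>Factors of index \<open>i > n\<close> are 1 plus terms of degree above \<open>n\<close>,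
  so they do not affect the coefficient. Finite truncations can thus stand in for the infinite
  product.\<close>

lemma complete_bell_fps_nth:
  fixes x :: "nat \<Rightarrow> 'a :: field_char_0"
  assumes "n \<le> m"
  shows "complete_bell_fps x $ n = (\<Prod>i=1..m. fps_exp (x i / fact i) oo fps_X ^ i) $ n"
  using assms
proof (induction m rule: dec_induct)
  case base
  show ?case
    using sum_bell_poly[of n x] by (cases "n = 0") (simp_all add: complete_bell_fps_def)
next
  case (step m)
  let ?P = "\<Prod>i=1..m. fps_exp (x i / fact i) oo fps_X ^ i"
  have "k = 0" if "Suc m * k \<le> n" for k
    using that step.hyps by (cases k) auto
  then have "{k. Suc m * k \<le> n} = {0}"
    by auto
  then have "((fps_exp (x (Suc m) / fact (Suc m)) oo fps_X ^ Suc m) * ?P) $ n = ?P $ n"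
    by (subst fps_compose_X_power_mult_nth) simp_all
  with step.IH show ?case
    by (simp add: mult.commute)
qed

text \<open>The series is formally the exponential of \<open>\<Sum> x_i X^i / i!\<close>, whose
  derivative is the second factor. The proof compares coefficients using truncated products.\<close>

lemma fps_deriv_complete_bell_fps:
  fixes x :: "nat \<Rightarrow> 'a :: field_char_0"
  shows "fps_deriv (complete_bell_fps x) =
    complete_bell_fps x * Abs_fps (\<lambda>r. x (Suc r) / fact r)"
proof (rule fps_ext)
  fix n
  \<comment> \<open>Truncation at \<open>Suc n\<close> because coefficient \<open>n\<close> of a
    derivative comes from coefficient \<open>n + 1\<close>.\<close>
  define P where "P = (\<Prod>i=1..Suc n. fps_exp (x i / fact i) oo fps_X ^ i)"
  define Q where "Q = (\<Sum>i=1..Suc n. fps_const (of_nat i * (x i / fact i)) * fps_X ^ (i - 1))"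
  have Q: "Q $ r = x (Suc r) / fact r" if "r \<le> n" for r
  proof -
    have "Q $ r = (\<Sum>i=1..Suc n. if i = Suc r then of_nat i * (x i / fact i) else 0)"
      unfolding Q_def fps_sum_nth by (intro sum.cong) auto
    also have "\<dots> = of_nat (Suc r) * (x (Suc r) / fact (Suc r))"
      using that by (subst sum.delta) auto
    also have "\<dots> = x (Suc r) / fact r"
      by (simp add: divide_simps del: of_nat_Suc)
    finally show ?thesis .
  qed
  have "fps_deriv (complete_bell_fps x) $ n = fps_deriv P $ n"
    unfolding fps_deriv_nth P_def by (subst complete_bell_fps_nth[of _ "Suc n"]) simp_all
  also have "fps_deriv P = P * Q"
    unfolding P_def Q_def by (intro fps_deriv_prod_logderiv fps_deriv_exp_compose_X_power) auto
  also have "(P * Q) $ n = (complete_bell_fps x * Abs_fps (\<lambda>r. x (Suc r) / fact r)) $ n"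
    unfolding fps_mult_nth P_def
    by (intro sum.cong refl) (simp add: Q complete_bell_fps_nth[of _ "Suc n"])
  finally show "fps_deriv (complete_bell_fps x) $ n =
    (complete_bell_fps x * Abs_fps (\<lambda>r. x (Suc r) / fact r)) $ n" .
qed

section \<open>Recursions for the partial sums and Newton's identity\<close>

lemma L_star_partial_zero: "L_star_partial 0 chi N = 1"
proof -
  have "{ks :: nat list. length ks = 0 \<and> sorted ks \<and> set ks \<subseteq> {1..N}} = {[]}"
    by auto
  then show ?thesis by (simp add: L_star_partial_def)
qed

lemma L_star_partial_Suc_0: "L_star_partial (Suc n) chi 0 = 0"
proof -
  have "{ks :: nat list. length ks = Suc n \<and> sorted ks \<and> set ks \<subseteq> {1..0}} = {}"
    by (auto simp: length_Suc_conv)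
  then show ?thesis by (simp add: L_star_partial_def)
qed

text \<open>A nondecreasing list bounded by \<open>Suc N\<close> either avoids \<open>Suc N\<close>
  or ends with it. Removing that last entry leaves a list that may still contain
  \<open>Suc N\<close>, so the last factor is taken at \<open>Suc N\<close>.\<close>

lemma L_star_partial_Suc_Suc:
  "L_star_partial (Suc n) chi (Suc N) =
     L_star_partial (Suc n) chi N +
     chi (int (Suc N)) / of_nat (Suc N) * L_star_partial n chi (Suc N)"
proof -
  define S where "S n N = {ks. length ks = n \<and> sorted ks \<and> set ks \<subseteq> {1..N}}" for n N :: nat
  define t where "t ks = (\<Prod>k\<leftarrow>ks. chi (int k) / of_nat k)" for ks :: "nat list"
  define snoc where "snoc ks = ks @ [Suc N]" for ks
  have finS: "finite (S n N)" for n N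
    by (rule finite_subset[OF _ finite_lists_length_eq[of "{1..N}" n]]) (auto simp: S_def)
  have "S (Suc n) (Suc N) = S (Suc n) N \<union> snoc ` S n (Suc N)"
  proof (intro equalityI subsetI)
    fix ks assume ks: "ks \<in> S (Suc n) (Suc N)"
    then obtain ms m where ms: "ks = ms @ [m]"
      by (cases ks rule: rev_cases) (auto simp: S_def)
    show "ks \<in> S (Suc n) N \<union> snoc ` S n (Suc N)"
    proof (cases "m = Suc N")
      case True
      with ks ms show ?thesis by (auto simp: S_def snoc_def sorted_append)
    next
      case False
      \<comment> \<open>The last entry is now at most \<open>N\<close>, and sortedness carries this
        bound to all entries.\<close>
      with ks ms have "ks \<in> S (Suc n) N" by (fastforce simp: S_def sorted_append)
      then show ?thesis ..
    qed
  next
    fix ks assume "ks \<in> S (Suc n) N \<union> snoc ` S n (Suc N)"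
    then show "ks \<in> S (Suc n) (Suc N)"
      by (fastforce simp: S_def snoc_def sorted_append)
  qed
  moreover have "S (Suc n) N \<inter> snoc ` S n (Suc N) = {}"
    by (auto simp: S_def snoc_def)
  ultimately have "(\<Sum>ks\<in>S (Suc n) (Suc N). t ks) = (\<Sum>ks\<in>S (Suc n) N. t ks) + (\<Sum>ks\<in>snoc ` S n (Suc N). t ks)"
    using finS by (simp add: sum.union_disjoint)
  also have "(\<Sum>ks\<in>snoc ` S n (Suc N). t ks) =
      chi (int (Suc N)) / of_nat (Suc N) * (\<Sum>ks\<in>S n (Suc N). t ks)"
    by (subst sum.reindex) (auto simp: inj_on_def snoc_def t_def sum_distrib_left mult.commute)
  finally show ?thesis
    by (simp add: L_star_partial_def S_def t_def)
qed

lemma fps_mult_one_minus_linear_nth: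
  fixes f :: "'a :: comm_ring_1 fps"
  shows "(f * (1 - fps_const c * fps_X)) $ n = f $ n - (if n = 0 then 0 else c * f $ (n - 1))"
proof -
  have "f * (1 - fps_const c * fps_X) = f - fps_const c * (f * fps_X)"
    by (simp add: algebra_simps)
  then show ?thesis by simp
qed

text \<open>With \<open>c k = chi k / k\<close>, the generating function \<open>H N\<close> is the
  product of \<open>1 / (1 - c k X)\<close> over \<open>k \<le> N\<close>, and its logarithmic
  derivative \<open>\<Sum> c k / (1 - c k X)\<close> generates the power sums. Induction on
  \<open>N\<close> adds one factor at a time.\<close>

lemma L_star_partial_newton:
  "of_nat (Suc n) * L_star_partial (Suc n) chi N =
     (\<Sum>i=0..n. L_star_partial i chi N * (\<Sum>k=1..N. (chi (int k) / of_nat k) ^ Suc (n - i)))"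
proof -
  define H where "H N = Abs_fps (\<lambda>n. L_star_partial n chi N)" for N
  define c where "c k = chi (int k) / of_nat k" for k
  define P where "P N = Abs_fps (\<lambda>r. \<Sum>k=1..N. c k ^ Suc r)" for N
  have "fps_deriv (H N) = H N * P N"
  proof (induction N)
    case 0
    show ?case
      by (rule fps_ext) (simp add: H_def P_def fps_mult_nth L_star_partial_Suc_0)
  next
    case (Suc N)
    define C where "C = fps_const (c (Suc N))"
    \<comment> \<open>The geometric series, inverse to \<open>1 - C * fps_X\<close>.\<close>
    define g where "g = Abs_fps (\<lambda>n. c (Suc N) ^ n)"
    have g: "g * (1 - C * fps_X) = 1"
      unfolding C_def
      by (rule fps_ext) (simp add: fps_mult_one_minus_linear_nth g_def flip: power_Suc)
    have H: "H N = H (Suc N) * (1 - C * fps_X)"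
    proof (rule fps_ext)
      fix n show "H N $ n = (H (Suc N) * (1 - C * fps_X)) $ n"
        by (cases n)
           (simp_all add: H_def C_def c_def fps_mult_one_minus_linear_nth L_star_partial_zero
              L_star_partial_Suc_Suc)
    qed
    have P: "P (Suc N) = P N + C * g"
      by (rule fps_ext) (simp add: P_def C_def g_def)
    have "fps_deriv (H N) = fps_deriv (H (Suc N)) * (1 - C * fps_X) - C * H (Suc N)"
      by (subst H) (simp add: C_def algebra_simps)
    then have "fps_deriv (H (Suc N)) * (1 - C * fps_X) = H (Suc N) * (1 - C * fps_X) * P N + C * H (Suc N)"
      using Suc.IH H by (simp add: algebra_simps)
    also have "\<dots> = H (Suc N) * P (Suc N) * (1 - C * fps_X)"
    proof -
      have "C * H (Suc N) = C * H (Suc N) * (g * (1 - C * fps_X))" using g by simp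
      then show ?thesis by (simp add: P algebra_simps)
    qed
    finally have "fps_deriv (H (Suc N)) * (1 - C * fps_X) = H (Suc N) * P (Suc N) * (1 - C * fps_X)" .
    moreover have "1 - C * fps_X \<noteq> 0"
      using g by auto
    ultimately show ?case
      by (metis mult_right_cancel)
  qed
  then have "fps_deriv (H N) $ n = (H N * P N) $ n" by simp
  then show ?thesis
    by (simp add: H_def P_def c_def fps_mult_nth)
qed

section \<open>Periodicity and vanishing sums of Dirichlet characters\<close>

lemma dirichlet_character_one:
  assumes "dirichlet_character q chi"
  shows "chi 1 = 1"
proof -
  have "chi 1 * chi 1 = chi 1"
    using assms unfolding dirichlet_character_def by (metis mult_1)
  moreover have "chi 1 \<noteq> 0"
    using assms unfolding dirichlet_character_def by simp
  ultimately show ?thesis by simp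
qed

lemma dirichlet_character_periodic:
  assumes "dirichlet_character q chi"
  shows "chi (int (m * q + k)) = chi (int k)"
proof (induction m)
  case (Suc m)
  have "chi (int (Suc m * q + k)) = chi (int (m * q + k) + int q)"
    by (simp add: algebra_simps)
  also have "\<dots> = chi (int (m * q + k))"
    using assms unfolding dirichlet_character_def by blast
  finally show ?case using Suc.IH by simp
qed simp

lemma dirichlet_character_mod:
  assumes "dirichlet_character q chi"
  shows "chi (int (k mod q)) = chi (int k)"
  using dirichlet_character_periodic[OF assms, of "k div q" "k mod q"] by simp

text \<open>Period 1 forces \<open>chi\<close> to be constantly \<open>chi 1 = 1\<close>, so a
  character modulo 1 is principal.\<close>

lemma nonprincipal_modulus_gt_1:
  assumes "dirichlet_character q chi" and "\<not> principal_character q chi"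
  shows "q > 1"
proof (rule ccontr)
  assume "\<not> q > 1"
  with assms have q: "q = 1" by (auto simp: dirichlet_character_def)
  have per: "chi (a + 1) = chi a" for a
    using assms q by (simp add: dirichlet_character_def)
  have "chi a = 1" for a
  proof (induction a rule: int_induct[where k = 1])
    case base
    show ?case using dirichlet_character_one[OF assms(1)] .
  next
    case (step1 i)
    then show ?case using per by simp
  next
    case (step2 i)
    then show ?case using per[of "i - 1"] by simp
  qed
  with assms show False by (simp add: principal_character_def)
qed

text \<open>Multiplication by a unit \<open>a\<close> with \<open>chi a \<noteq> 1\<close> permutes
  the residues, so the sum equals \<open>chi a\<close> times itself.\<close>

lemma nonprincipal_character_sum:
  assumes chi: "dirichlet_character q chi" and "\<not> principal_character q chi"
  shows "(\<Sum>j<q. chi (int j)) = 0"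
proof -
  have q: "q > 0" using chi by (simp add: dirichlet_character_def)
  obtain b where b: "coprime b (int q)" "chi b \<noteq> 1"
    using assms by (auto simp: principal_character_def)
  define a where "a = nat (b mod int q)"
  have a: "int a = b mod int q" using q by (simp add: a_def)
  have "coprime a q"
    using b(1) q unfolding coprime_int_iff[symmetric] a by (simp add: coprime_mod_left_iff)
  have "chi (b mod int q) = chi b"
  proof -
    have *: "chi (x + int q * int m) = chi x" for x m
    proof (induction m)
      case (Suc m)
      have "chi (x + int q * int (Suc m)) = chi (x + int q * int m + int q)"
        by (simp add: algebra_simps)
      then show ?case using chi Suc.IH unfolding dirichlet_character_def by metis
    qed simp
    show ?thesis
    \<comment> \<open>Shifts are available for natural multiples of \<open>q\<close> only: a
      nonnegative quotient shifts the residue up to \<open>b\<close>, a negative one shifts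
      \<open>b\<close> up to its residue.\<close>
    proof (cases "b div int q \<ge> 0")
      case True
      then show ?thesis using *[of "b mod int q" "nat (b div int q)"] by simp
    next
      case False
      then show ?thesis using *[of b "nat (- (b div int q))"]
        by (simp add: minus_mult_div_eq_mod[symmetric])
    qed
  qed
  then have a1: "chi (int a) \<noteq> 1" using b a by simp
  have inj: "inj_on (\<lambda>j. a * j mod q) {..<q}"
  proof (rule inj_onI)
    fix i j assume ij: "i \<in> {..<q}" "j \<in> {..<q}" "a * i mod q = a * j mod q"
    then have "[i = j] (mod q)"
      using \<open>coprime a q\<close> by (simp add: cong_def[symmetric] cong_mult_lcancel_nat)
    then show "i = j" using ij by (simp add: cong_def)
  qed
  moreover have "(\<lambda>j. a * j mod q) ` {..<q} = {..<q}"
    using inj q by (intro endo_inj_surj) auto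
  ultimately have "(\<Sum>j<q. chi (int j)) = (\<Sum>j<q. chi (int (a * j mod q)))"
    using sum.reindex[OF inj, of "\<lambda>j. chi (int j)"] by simp
  also have "\<dots> = (\<Sum>j<q. chi (int a) * chi (int j))"
    using chi by (simp only: dirichlet_character_mod[OF chi]) (simp add: dirichlet_character_def)
  also have "\<dots> = chi (int a) * (\<Sum>j<q. chi (int j))"
    by (rule sum_distrib_left[symmetric])
  finally have "(\<Sum>j<q. chi (int j)) = chi (int a) * (\<Sum>j<q. chi (int j))" .
  then show ?thesis using a1 by (metis mult_cancel_right1)
qed

section \<open>Limits of the power sums as polygamma values\<close>

lemma LIMSEQ_residue_classes:
  fixes f :: "nat \<Rightarrow> 'a :: metric_space"
  assumes "q > 0" and "\<And>i. i < q \<Longrightarrow> (\<lambda>m. f (m * q + i)) \<longlonglongrightarrow> L"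
  shows "f \<longlonglongrightarrow> L"
proof (rule tendstoI)
  fix e :: real assume "e > 0"
  then have "\<forall>i\<in>{..<q}. \<forall>\<^sub>F m in sequentially. dist (f (m * q + i)) L < e"
    using assms(2) by (auto dest: tendstoD)
  then have "\<forall>\<^sub>F m in sequentially. \<forall>i\<in>{..<q}. dist (f (m * q + i)) L < e"
    by (intro eventually_ball_finite) auto
  then obtain M where M: "\<And>m i. m \<ge> M \<Longrightarrow> i < q \<Longrightarrow> dist (f (m * q + i)) L < e"
    by (auto simp: eventually_sequentially)
  have "dist (f n) L < e" if "n \<ge> M * q" for n
    using M[of "n div q" "n mod q"] that assms(1) by (simp add: less_eq_div_iff_mult_less_eq)
  then show "\<forall>\<^sub>F n in sequentially. dist (f n) L < e"
    by (auto simp: eventually_sequentially)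
qed

text \<open>For \<open>r > 0\<close> every inner sum converges by itself. For \<open>r = 0\<close>
  each one grows like \<open>ln M\<close>, and the vanishing of \<open>sum c A\<close> cancels these
  logarithms.\<close>

lemma Polygamma_weighted_sum_LIMSEQ:
  fixes c z :: "'b \<Rightarrow> complex"
  assumes "finite A" and "\<And>j. j \<in> A \<Longrightarrow> z j \<noteq> 0" and "r = 0 \<Longrightarrow> sum c A = 0"
  shows "(\<lambda>M. \<Sum>j\<in>A. c j * (\<Sum>m<M. inverse ((z j + of_nat m) ^ Suc r)))
           \<longlonglongrightarrow> (\<Sum>j\<in>A. c j * ((-1) ^ Suc r * Polygamma r (z j) / fact r))"
proof (cases "r = 0")
  case True
  have "(\<lambda>M. \<Sum>j\<in>A. - c j * (of_real (ln (real M)) - (\<Sum>m<M. inverse (z j + of_nat m))))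
      \<longlonglongrightarrow> (\<Sum>j\<in>A. - c j * Digamma (z j))"
    using assms by (intro tendsto_intros Digamma_LIMSEQ) auto
  also have "(\<lambda>M. \<Sum>j\<in>A. - c j * (of_real (ln (real M)) - (\<Sum>m<M. inverse (z j + of_nat m)))) =
      (\<lambda>M. (\<Sum>j\<in>A. c j * (\<Sum>m<M. inverse (z j + of_nat m))) - sum c A * of_real (ln (real M)))"
    by (simp add: fun_eq_iff algebra_simps sum_subtractf sum_distrib_left sum_distrib_right sum_negf)
  finally show ?thesis
    using assms True by simp
next
  case False
  then show ?thesis
    using assms(2) Polygamma_LIMSEQ unfolding sums_def by (intro tendsto_intros) auto
qed

text \<open>Writing \<open>k = m * q + j\<close> gives
  \<open>chi k / k = (chi j / q) / (j / q + m)\<close>, so complete blocks of length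
  \<open>q\<close> form weighted polygamma sums. An incomplete block adds fewer than
  \<open>q\<close> terms, each tending to 0.\<close>

lemma character_power_sum_LIMSEQ:
  assumes chi: "dirichlet_character q chi" and nonprincipal: "\<not> principal_character q chi"
    and \<Phi>: "\<Phi> = {j. 1 \<le> j \<and> j \<le> q - 1 \<and> gcd j q = 1}"
  shows "(\<lambda>N. \<Sum>k=1..N. (chi (int k) / of_nat k) ^ Suc r) \<longlonglongrightarrow>
    (\<Sum>j\<in>\<Phi>. (- chi (int j) / of_nat q) ^ Suc r * Polygamma r (of_nat j / of_nat q) / fact r)"
    (is "_ \<longlonglongrightarrow> ?L")
proof -
  have q: "q > 1" using nonprincipal_modulus_gt_1[OF chi nonprincipal] .
  define t where "t k = (chi (int k) / of_nat k) ^ Suc r" for k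
  have chi0: "chi (int j) = 0" if "j < q" "j \<notin> \<Phi>" for j
  proof -
    have "\<not> coprime j q"
      using that q unfolding \<Phi> by (cases "j = 0") (auto simp: coprime_iff_gcd_eq_1)
    then show ?thesis
      using chi by (simp add: dirichlet_character_def)
  qed
  have \<Phi>_sub: "\<Phi> \<subseteq> {..<q}" using q by (auto simp: \<Phi>)
  have fin: "finite \<Phi>" using \<Phi>_sub finite_subset by blast
  \<comment> \<open>Also valid for \<open>m = j = 0\<close>, where both sides are 0 because division
    by zero yields 0.\<close>
  have t_eq: "t (m * q + j) =
      (chi (int j) / of_nat q) ^ Suc r * inverse ((of_nat j / of_nat q + of_nat m) ^ Suc r)" for m j
  proof -
    have "of_nat (m * q + j) = (of_nat q :: complex) * (of_nat j / of_nat q + of_nat m)"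
      using q by (simp add: field_simps)
    then show ?thesis
      unfolding t_def dirichlet_character_periodic[OF chi]
      by (simp only: power_divide power_mult_distrib) (simp add: field_simps)
  qed
  have "(\<Sum>j\<in>\<Phi>. chi (int j)) = (\<Sum>j<q. chi (int j))"
    using \<Phi>_sub chi0 by (intro sum.mono_neutral_left) auto
  then have sum0: "(\<Sum>j\<in>\<Phi>. (chi (int j) / of_nat q) ^ Suc r) = 0" if "r = 0"
    using that nonprincipal_character_sum[OF chi nonprincipal]
    by (simp add: sum_divide_distrib[symmetric])
  have blocks: "(\<Sum>k<M * q. t k) = (\<Sum>j\<in>\<Phi>. (chi (int j) / of_nat q) ^ Suc r *
      (\<Sum>m<M. inverse ((of_nat j / of_nat q + of_nat m) ^ Suc r)))" for M
  proof -
    have "(\<Sum>k<M * q. t k) = (\<Sum>m<M. \<Sum>k=m*q..<m*q+q. t k)"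
      by (rule sum.nat_group[symmetric])
    also have "\<dots> = (\<Sum>m<M. \<Sum>j<q. t (m * q + j))"
    proof (rule sum.cong[OF refl])
      fix m
      show "(\<Sum>k=m*q..<m*q+q. t k) = (\<Sum>j<q. t (m * q + j))"
        using sum.shift_bounds_nat_ivl[of t 0 "m * q" q]
        by (simp add: atLeast0LessThan add.commute)
    qed
    also have "\<dots> = (\<Sum>m<M. \<Sum>j\<in>\<Phi>. t (m * q + j))"
      using \<Phi>_sub chi0 by (intro sum.cong refl sum.mono_neutral_right) (auto simp: t_eq)
    also have "\<dots> = (\<Sum>j\<in>\<Phi>. \<Sum>m<M. t (m * q + j))"
      by (rule sum.swap)
    finally show ?thesis
      by (simp only: t_eq sum_distrib_left)
  qed
  have "(\<lambda>M. \<Sum>k<M * q. t k) \<longlonglongrightarrow> (\<Sum>j\<in>\<Phi>. (chi (int j) / of_nat q) ^ Suc r *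
      ((-1) ^ Suc r * Polygamma r (of_nat j / of_nat q) / fact r))"
    unfolding blocks using q fin sum0
    by (intro Polygamma_weighted_sum_LIMSEQ) (auto simp: \<Phi>)
  also have "(\<Sum>j\<in>\<Phi>. (chi (int j) / of_nat q) ^ Suc r *
      ((-1) ^ Suc r * Polygamma r (of_nat j / of_nat q) / fact r)) = ?L"
  proof (intro sum.cong refl)
    fix j
    have "(- chi (int j) / of_nat q) ^ Suc r = (-1) ^ Suc r * (chi (int j) / of_nat q) ^ Suc r"
      unfolding power_mult_distrib[symmetric] by simp
    then show "(chi (int j) / of_nat q) ^ Suc r *
        ((-1) ^ Suc r * Polygamma r (of_nat j / of_nat q) / fact r) =
        (- chi (int j) / of_nat q) ^ Suc r * Polygamma r (of_nat j / of_nat q) / fact r"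
      by (simp only: mult.assoc mult.left_commute times_divide_eq_right)
  qed
  finally have multiples: "(\<lambda>M. \<Sum>k<M * q. t k) \<longlonglongrightarrow> ?L" .
  \<comment> \<open>Passing from \<open>i\<close> to \<open>Suc i\<close> adds the single term
    \<open>t (M * q + i)\<close>, which is bounded by a power of \<open>1 / (M * q + i)\<close> up
    to a constant.\<close>
  have offsets: "(\<lambda>M. \<Sum>k<M * q + i. t k) \<longlonglongrightarrow> ?L" for i
  proof (induction i)
    case 0
    then show ?case using multiples by simp
  next
    case (Suc i)
    have "filterlim (\<lambda>M. M * q + i) at_top sequentially"
      by (rule filterlim_at_top_mono[OF filterlim_ident]) (use q in \<open>auto intro!: always_eventually trans_le_add1\<close>)
    then have "(\<lambda>M. inverse (of_nat (M * q + i)) :: complex) \<longlonglongrightarrow> 0"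
      using filterlim_compose[OF lim_inverse_n] by blast
    then have "(\<lambda>M. (chi (int i) * inverse (of_nat (M * q + i))) ^ Suc r) \<longlonglongrightarrow> (chi (int i) * 0) ^ Suc r"
      by (intro tendsto_intros)
    then have "(\<lambda>M. t (M * q + i)) \<longlonglongrightarrow> 0"
      unfolding t_def dirichlet_character_periodic[OF chi] by (simp add: field_simps)
    from tendsto_add[OF Suc.IH this] show ?case by simp
  qed
  have "(\<lambda>N. \<Sum>k<N. t k) \<longlonglongrightarrow> ?L"
    using q by (intro LIMSEQ_residue_classes[of q "\<lambda>N. \<Sum>k<N. t k", OF _ offsets]) simp
  then have "(\<lambda>N. \<Sum>k<Suc N. t k) \<longlonglongrightarrow> ?L"
    by (rule LIMSEQ_Suc)
  \<comment> \<open>The extra term at \<open>k = 0\<close> vanishes by the convention for division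
    by zero.\<close>
  moreover have "(\<Sum>k<Suc N. t k) = (\<Sum>k=1..N. t k)" for N
    by (intro sum.mono_neutral_right) (auto simp: t_def)
  ultimately show ?thesis
    by (simp add: t_def)
qed

section \<open>Comparison of the two recursions\<close>

theorem theorem5:
  fixes chi :: "int \<Rightarrow> complex" and q n :: nat and \<Phi> :: "nat set"
  assumes "primitive_character q chi" and "\<not> principal_character q chi"
    and "\<Phi> = {j. 1 \<le> j \<and> j \<le> q - 1 \<and> gcd j q = 1}"
    and "n \<ge> 1"
  shows "convergent (L_star_partial n chi) \<and>
    L_star n chi =
      (-1) ^ n / of_nat q ^ n *
      (\<Sum>\<kappa> \<in> {\<kappa> \<in> \<Phi> \<rightarrow>\<^sub>E (UNIV :: nat set). (\<Sum>j\<in>\<Phi>. \<kappa> j) = n}.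
         \<Prod>j\<in>\<Phi>. if \<kappa> j = 0 then 1
               else chi (int j) ^ \<kappa> j / fact (\<kappa> j) *
                 (\<Sum>k=1..\<kappa> j. bell_poly (\<kappa> j) k
                    (\<lambda>i. Polygamma (i - 1) (of_nat j / of_nat q :: complex))))"
proof -
  have chi: "dirichlet_character q chi"
    using assms(1) by (simp add: primitive_character_def)
  have fin: "finite \<Phi>"
    unfolding assms(3) by (rule finite_subset[of _ "{..q - 1}"]) auto
  define x where "x j i = Polygamma (i - 1) (of_nat j / of_nat q :: complex)" for j i :: nat
  \<comment> \<open>\<open>d j\<close> absorbs the sign, the character value and the power of
    \<open>q\<close>. \<open>E j\<close> is the Bell series with \<open>X\<close> replaced by
    \<open>d j * X\<close>, \<open>Q j\<close> its logarithmic derivative, and \<open>G\<close> the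
    generating function of the right-hand sides.\<close>
  define d where "d j = - chi (int j) / of_nat q" for j
  define E where "E j = Abs_fps (\<lambda>n. d j ^ n * complete_bell_fps (x j) $ n)" for j
  define Q where "Q j = Abs_fps (\<lambda>r. d j ^ Suc r * (x j (Suc r) / fact r))" for j
  define G where "G = (\<Prod>j\<in>\<Phi>. E j)"
  have "fps_deriv (E j) = E j * Q j" for j
  proof (rule fps_ext)
    fix n
    have "fps_deriv (E j) $ n = d j ^ Suc n * fps_deriv (complete_bell_fps (x j)) $ n"
      by (simp add: E_def)
    also have "\<dots> = (\<Sum>i=0..n. d j ^ Suc n * (complete_bell_fps (x j) $ i * (x j (Suc (n - i)) / fact (n - i))))"
      by (simp add: fps_deriv_complete_bell_fps fps_mult_nth sum_distrib_left)
    also have "\<dots> = (E j * Q j) $ n"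
      unfolding fps_mult_nth
    proof (intro sum.cong refl)
      fix i assume "i \<in> {0..n}"
      then have "d j ^ Suc n = d j ^ i * d j ^ Suc (n - i)"
        by (simp add: power_add[symmetric] del: power_Suc)
      then show "d j ^ Suc n * (complete_bell_fps (x j) $ i * (x j (Suc (n - i)) / fact (n - i))) =
          E j $ i * Q j $ (n - i)"
        by (simp add: E_def Q_def del: power_Suc)
    qed
    finally show "fps_deriv (E j) $ n = (E j * Q j) $ n" .
  qed
  then have deriv_G: "fps_deriv G = G * (\<Sum>j\<in>\<Phi>. Q j)"
    unfolding G_def by (intro fps_deriv_prod_logderiv fin)
  \<comment> \<open>Coefficient \<open>r\<close> belongs to the power sum of exponent
    \<open>r + 1\<close>, the usual shift in a logarithmic derivative.\<close>
  have power_sums: "(\<lambda>N. \<Sum>k=1..N. (chi (int k) / of_nat k) ^ Suc r) \<longlonglongrightarrow> (\<Sum>j\<in>\<Phi>. Q j) $ r" for r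
    using character_power_sum_LIMSEQ[OF chi assms(2,3), of r]
    by (simp add: Q_def d_def x_def fps_sum_nth)
  have lim: "L_star_partial m chi \<longlonglongrightarrow> G $ m" for m
  \<comment> \<open>Newton's identity expresses index \<open>l + 1\<close> through all indices up to
    \<open>l\<close>, hence strong induction; \<open>deriv_G\<close> gives the coefficients of
    \<open>G\<close> the same recursion.\<close>
  proof (induction m rule: less_induct)
    case (less m)
    show ?case
    proof (cases m)
      case 0
      have "G $ 0 = 1"
        unfolding G_def using fin
        by (induction \<Phi> rule: finite_induct) (simp_all add: E_def complete_bell_fps_def)
      moreover have "L_star_partial 0 chi = (\<lambda>_. 1)"
        by (simp add: fun_eq_iff L_star_partial_zero)
      ultimately show ?thesis
        using 0 by simp
    next
      case (Suc l)
      have "(\<lambda>N. (\<Sum>i=0..l. L_star_partial i chi N *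
              (\<Sum>k=1..N. (chi (int k) / of_nat k) ^ Suc (l - i))) / of_nat (Suc l))
          \<longlonglongrightarrow> (\<Sum>i=0..l. G $ i * (\<Sum>j\<in>\<Phi>. Q j) $ (l - i)) / of_nat (Suc l)"
        using Suc by (intro tendsto_intros power_sums less.IH) (auto simp del: of_nat_Suc)
      also have "(\<Sum>i=0..l. G $ i * (\<Sum>j\<in>\<Phi>. Q j) $ (l - i)) = of_nat (Suc l) * G $ Suc l"
        using arg_cong[OF deriv_G, of "\<lambda>f. f $ l"] by (simp add: fps_mult_nth)
      finally show ?thesis
        using Suc by (simp only: L_star_partial_newton[symmetric] nonzero_mult_div_cancel_left[OF of_nat_neq_0])
    qed
  qed
  have "G $ n = (\<Sum>\<kappa> \<in> {\<kappa> \<in> \<Phi> \<rightarrow>\<^sub>E UNIV. (\<Sum>j\<in>\<Phi>. \<kappa> j) = n}. \<Prod>j\<in>\<Phi>. E j $ \<kappa> j)"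
    unfolding G_def by (rule fps_prod_nth_PiE[OF fin])
  also have "\<dots> = (\<Sum>\<kappa> \<in> {\<kappa> \<in> \<Phi> \<rightarrow>\<^sub>E UNIV. (\<Sum>j\<in>\<Phi>. \<kappa> j) = n}.
      (-1) ^ n / of_nat q ^ n * (\<Prod>j\<in>\<Phi>. if \<kappa> j = 0 then 1
        else chi (int j) ^ \<kappa> j / fact (\<kappa> j) * (\<Sum>k=1..\<kappa> j. bell_poly (\<kappa> j) k (x j))))"
    (is "_ = (\<Sum>\<kappa>\<in>_. _ * (\<Prod>j\<in>\<Phi>. ?F \<kappa> j))")
  proof (intro sum.cong refl)
    fix \<kappa> assume "\<kappa> \<in> {\<kappa> \<in> \<Phi> \<rightarrow>\<^sub>E (UNIV :: nat set). (\<Sum>j\<in>\<Phi>. \<kappa> j) = n}"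
    then have n: "(\<Sum>j\<in>\<Phi>. \<kappa> j) = n" by simp
    \<comment> \<open>For \<open>\<kappa> j = 0\<close> both sides are 1, by the choice of the
      constant coefficient in \<open>complete_bell_fps\<close>.\<close>
    have "E j $ \<kappa> j = (- 1 / of_nat q) ^ \<kappa> j * ?F \<kappa> j" for j
    proof -
      have "d j ^ \<kappa> j = (- 1 / of_nat q) ^ \<kappa> j * chi (int j) ^ \<kappa> j"
        unfolding power_mult_distrib[symmetric] by (simp add: d_def)
      then show ?thesis
        by (simp add: E_def complete_bell_fps_def)
    qed
    \<comment> \<open>The powers of \<open>-1 / q\<close> combine to exponent \<open>n\<close>
      because the \<open>\<kappa> j\<close> add up to \<open>n\<close>.\<close>
    then have "(\<Prod>j\<in>\<Phi>. E j $ \<kappa> j) = (- 1 / of_nat q) ^ n * (\<Prod>j\<in>\<Phi>. ?F \<kappa> j)"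
      by (simp add: prod.distrib power_sum[symmetric] n)
    then show "(\<Prod>j\<in>\<Phi>. E j $ \<kappa> j) = (-1) ^ n / of_nat q ^ n * (\<Prod>j\<in>\<Phi>. ?F \<kappa> j)"
      by (simp only: power_divide)
  qed
  finally have "G $ n = (-1) ^ n / of_nat q ^ n *
      (\<Sum>\<kappa> \<in> {\<kappa> \<in> \<Phi> \<rightarrow>\<^sub>E UNIV. (\<Sum>j\<in>\<Phi>. \<kappa> j) = n}. \<Prod>j\<in>\<Phi>. ?F \<kappa> j)"
    by (simp only: sum_distrib_left)
  moreover have "L_star n chi = G $ n"
    unfolding L_star_def by (rule limI[OF lim])
  moreover have "convergent (L_star_partial n chi)"
    using lim by (rule convergentI)
  ultimately show ?thesis
    unfolding x_def by (simp only: simp_thms)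
qed

end
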